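(* Let $m\ge 2$ be an integer and let $k\ge 5$ be an odd integer. Let $P^{-}(m)$ denote the least prime factor of $m$. If $P^{-}(m)\ge (k+2)/2$, then there is a constant $C_{m,k}>0$, depending only on $m$ and $k$, such that for all positive integers $n$, \[ r_k(\mathbb{Z}_m^n)\;\ge\; C_{m,k}\,\frac{\bigl\lfloor \frac{k-1}{k+1}m+1\bigr\rfloor^{n}}{n^{\lfloor \frac{k-1}{k+1}m\rfloor/2}}. \]
   Context: $\mathbb{Z}_m^n=(\mathbb{Z}/m\mathbb{Z})^n$ with componentwise addition. An arithmetic progression of length $k$ in $\mathbb{Z}_m^n$ is a sequence $\mathbf{v},\mathbf{v}+\mathbf{c},\mathbf{v}+2\mathbf{c},\dots,\mathbf{v}+(k-1)\mathbf{c}$ with $\mathbf{v},\mathbf{c}\in\mathbb{Z}_m^n$ and $\mathbf{c}\neq 0$ (i.e. a non-constant progression). $r_k(\mathbb{Z}_m^n)$ denotes the maximal size of a subset of $\mathbb{Z}_m^n$ containing no arithmetic progression of length $k$. *)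

theory Defs
  imports Complex_Main "HOL-Library.FuncSet" "HOL-Computational_Algebra.Primes"
begin

text \<open>Residue classes modulo \<open>m\<close> are represented by their remainders in \<open>{..<m}\<close>, and
  elements of \<open>(\<int>/m\<int>)\<^sup>n\<close> by extensional functions on \<open>{..<n}\<close>, so that each element
  has exactly one representative and \<open>card\<close> counts elements of the group.\<close>

definition zmod_vecs :: "nat \<Rightarrow> nat \<Rightarrow> (nat \<Rightarrow> nat) set" where
  "zmod_vecs m n = {..<n} \<rightarrow>\<^sub>E {..<m}"

definition zmod_zero :: "nat \<Rightarrow> nat \<Rightarrow> nat" where
  "zmod_zero n = (\<lambda>i\<in>{..<n}. 0)"

definition zmod_add :: "nat \<Rightarrow> nat \<Rightarrow> (nat \<Rightarrow> nat) \<Rightarrow> (nat \<Rightarrow> nat) \<Rightarrow> nat \<Rightarrow> nat" where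
  "zmod_add m n v w = (\<lambda>i\<in>{..<n}. (v i + w i) mod m)"

definition zmod_mult :: "nat \<Rightarrow> nat \<Rightarrow> nat \<Rightarrow> (nat \<Rightarrow> nat) \<Rightarrow> nat \<Rightarrow> nat" where
  "zmod_mult m n j v = (\<lambda>i\<in>{..<n}. (j * v i) mod m)"

text \<open>Only the common difference is required to be nonzero: the \<open>k\<close> terms of a progression
  need not be pairwise distinct.\<close>

definition contains_AP :: "nat \<Rightarrow> nat \<Rightarrow> nat \<Rightarrow> (nat \<Rightarrow> nat) set \<Rightarrow> bool" where
  "contains_AP k m n A \<longleftrightarrow>
    (\<exists>v\<in>zmod_vecs m n. \<exists>c\<in>zmod_vecs m n. c \<noteq> zmod_zero n \<and>
      (\<forall>j<k. zmod_add m n v (zmod_mult m n j c) \<in> A))"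

definition r_AP :: "nat \<Rightarrow> nat \<Rightarrow> nat \<Rightarrow> nat" where
  "r_AP k m n = Max {card A | A. A \<subseteq> zmod_vecs m n \<and> \<not> contains_AP k m n A}"

definition least_prime_factor :: "nat \<Rightarrow> nat" where
  "least_prime_factor m = Min (prime_factors m)"

end

theory Submission
  imports Defs
begin

text \<open>Put \<open>l = (k + 1) / 2\<close> and consider vectors whose digits lie in \<open>{0, \<dots>, d - 1}\<close> with
  \<open>d - 1 = \<lfloor>(l - 1) m / l\<rfloor>\<close>, every digit occurring a prescribed number of times.  For a
  progression inside such a set and a coordinate with difference \<open>c \<noteq> 0\<close>, Dirichlet approximation
  gives \<open>1 \<le> q < l\<close> such that \<open>q c\<close> is congruent to some \<open>s \<noteq> 0\<close> with \<open>\<bar>s\<bar> \<le> m / l\<close>.  If \<open>y\<close> is the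
  digit of the middle term, then \<open>y + \<bar>s\<bar> < m\<close>, and this is the digit of the term \<open>q\<close> steps before
  or after the middle.  So wherever the progression moves, some term has a larger digit than the
  middle one; the weight \<open>k\<^sup>a - 1\<close> of a digit \<open>a\<close> makes this incompatible with all terms having the
  same digit counts.  By Chebyshev's inequality, at least half of all vectors have digit counts
  within \<open>sqrt (2 n)\<close> of \<open>n / d\<close>, which leaves \<open>O(n\<^bsup>(d - 1) / 2\<^esup>)\<close> possible count vectors, so one
  of them is attained by sufficiently many vectors.\<close>

section \<open>Diophantine approximation modulo \<open>m\<close> and progressions in one
  coordinate\<close>

text \<open>Pigeonhole on the residues of \<open>0, c, ..., (l - 1) * c\<close>, where
  \<open>b j\<close> is the index of the box of length \<open>m / l\<close> containing
  \<open>r j\<close>. If two residues share a box, their difference is \<open>s\<close>; otherwise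
  all \<open>l\<close> boxes are hit, and the residue in the last one lies within
  \<open>m / l\<close> below \<open>m\<close>. The second case is what allows
  \<open>q < l\<close>.\<close>

lemma dirichlet_approx_mod:
  fixes m c l :: nat
  assumes "m > 0" "l \<ge> 2"
  shows "\<exists>q s. 1 \<le> q \<and> q < l \<and> int m dvd int q * int c - s \<and> \<bar>s\<bar> * int l \<le> int m"
proof -
  define r where "r j = (j * c) mod m" for j :: nat
  define b where "b j = (l * r j) div m" for j :: nat
  have r_lt: "r j < m" for j using assms by (simp add: r_def)
  have r_dvd: "int m dvd int j * int c - int (r j)" for j
    unfolding r_def by (simp add: zmod_int)
  have b_lt: "b j < l" for j
    using r_lt[of j] assms by (simp add: b_def div_less_iff_less_mult)
  have b_bounds: "b j * m \<le> l * r j \<and> l * r j < b j * m + m" for j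
    using assms div_mult_mod_eq[of "l * r j" m] mod_less_divisor[of m "l * r j"]
    unfolding b_def by linarith
  show ?thesis
  proof (cases "inj_on b {..<l}")
    case False
    then obtain i j where ij: "i < j" "j < l" "b i = b j"
      by (metis inj_on_def lessThan_iff nat_neq_iff)
    define s where "s = int (r j) - int (r i)"
    have 1: "int m dvd int (j - i) * int c - s"
    proof -
      have "int (j - i) * int c - s
          = (int j * int c - int (r j)) - (int i * int c - int (r i))"
        using ij by (simp add: s_def of_nat_diff algebra_simps)
      then show ?thesis using r_dvd by (metis dvd_diff)
    qed
    have "l * r j \<le> l * r i + m" "l * r i \<le> l * r j + m"
      using b_bounds[of i] b_bounds[of j] unfolding ij(3) by linarith+
    then have "int (l * r j) \<le> int (l * r i + m)" "int (l * r i) \<le> int (l * r j + m)"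
      by (simp_all only: of_nat_le_iff)
    then have "s * int l \<le> int m" "- s * int l \<le> int m"
      by (simp_all add: s_def algebra_simps)
    then have "\<bar>s\<bar> * int l \<le> int m" by (cases "s \<ge> 0") simp_all
    with 1 ij show ?thesis by (intro exI[of _ "j - i"] exI[of _ s]) auto
  next
    case True
    then have "b ` {..<l} = {..<l}"
      using b_lt by (intro endo_inj_surj) auto
    then obtain q where q: "q < l" "b q = l - 1"
      using assms by (metis (no_types, lifting) diff_less imageE lessThan_iff less_le_trans pos2 zero_less_one)
    have "b 0 = 0" by (simp add: b_def r_def)
    with q assms have "q \<ge> 1" by (cases q) auto
    define s where "s = int (r q) - int m"
    have "int m dvd (int q * int c - int (r q)) + int m" using r_dvd by (metis dvd_add dvd_refl)
    then have 1: "int m dvd int q * int c - s" by (simp add: s_def algebra_simps)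
    have "(l - 1) * m \<le> l * r q" using b_bounds[of q] q by simp
    then have "int ((l - 1) * m) \<le> int (l * r q)" by (simp only: of_nat_le_iff)
    then have "(int l - 1) * int m \<le> int l * int (r q)" using assms by (simp add: of_nat_diff)
    then have "- s * int l \<le> int m" by (simp add: s_def algebra_simps)
    moreover have "s \<le> 0" using r_lt[of q] by (simp add: s_def)
    ultimately have "\<bar>s\<bar> * int l \<le> int m" by simp
    with 1 q \<open>q \<ge> 1\<close> show ?thesis by blast
  qed
qed

text \<open>Coprimality enters twice: for the multiplier \<open>q < l\<close> it gives
  \<open>s \<noteq> 0\<close>, and for \<open>l\<close> itself it excludes
  \<open>y + \<bar>s\<bar> = m\<close>, where the larger digit would wrap around to 0.\<close>

lemma exists_larger_term:
  fixes m l v c :: nat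
  assumes m: "m \<ge> 2" and l: "l \<ge> 2"
    and cop: "\<And>q. 1 \<le> q \<Longrightarrow> q \<le> l \<Longrightarrow> coprime q m"
    and c: "0 < c" "c < m"
    and mid: "(v + (l - 1) * c) mod m \<le> ((l - 1) * m) div l"
  shows "\<exists>j<2 * l - 1. (v + (l - 1) * c) mod m < (v + j * c) mod m"
proof -
  define y where "y = (v + (l - 1) * c) mod m"
  obtain q s where q: "1 \<le> q" "q < l" "int m dvd int q * int c - s" and s: "\<bar>s\<bar> * int l \<le> int m"
    using dirichlet_approx_mod[of m l c] m l by auto
  have s0: "s \<noteq> 0"
  proof
    assume "s = 0"
    then have "m dvd q * c" using q(3) by (metis diff_zero int_dvd_int_iff of_nat_mult)
    then have "m dvd c" using cop[of q] q by (simp add: coprime_commute coprime_dvd_mult_right_iff)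
    with c show False by (auto dest: dvd_imp_le)
  qed
  have ly: "int l * int y \<le> (int l - 1) * int m"
  proof -
    have "l * y \<le> l * (((l - 1) * m) div l)" using mid by (simp add: y_def)
    also have "\<dots> \<le> (l - 1) * m" by simp
    finally have "int (l * y) \<le> int ((l - 1) * m)" by (simp only: of_nat_le_iff)
    then show ?thesis using l by (simp add: of_nat_diff)
  qed
  have lm: "\<not> l dvd m"
    using cop[of l] l by (auto simp: coprime_absorb_left)
  have lt: "int y + \<bar>s\<bar> < int m"
  proof (rule ccontr)
    assume "\<not> ?thesis"
    \<comment> \<open>The bounds on \<open>y\<close> and \<open>\<bar>s\<bar>\<close> add up to
      exactly \<open>m\<close>, so both are equalities and \<open>l\<close> divides
      \<open>m\<close>.\<close>
    then have "int l * int m \<le> int l * (int y + \<bar>s\<bar>)" by (intro mult_left_mono) auto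
    with ly s have "int m = int l * \<bar>s\<bar>" by (simp add: algebra_simps)
    then have "int l dvd int m" by simp
    with lm show False by simp
  qed
  have ycong: "int m dvd int v + int (l - 1) * int c - int y"
    unfolding y_def by (simp add: zmod_int)
  \<comment> \<open>Moving \<open>q\<close> steps from the middle index \<open>l - 1\<close> in the
    direction of the sign of \<open>s\<close> adds \<open>\<bar>s\<bar>\<close>;
    \<open>q < l\<close> keeps the index between 0 and \<open>2 * l - 2\<close>.\<close>
  define j where "j = (if s > 0 then l - 1 + q else l - 1 - q)"
  have j: "int j = int (l - 1) + sgn s * int q"
    using q s0 by (auto simp: j_def of_nat_diff sgn_if)
  have "int v + int j * int c - (int y + \<bar>s\<bar>)
      = (int v + int (l - 1) * int c - int y) + sgn s * (int q * int c - s)"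
    unfolding j by (simp add: algebra_simps abs_sgn)
  then have "int m dvd int v + int j * int c - (int y + \<bar>s\<bar>)"
    using ycong q(3) by (metis dvd_add dvd_mult)
  then have "(int v + int j * int c) mod int m = (int y + \<bar>s\<bar>) mod int m"
    by (simp add: mod_eq_dvd_iff)
  then have "int ((v + j * c) mod m) = int y + \<bar>s\<bar>"
    using lt by (simp add: zmod_int)
  then have "y < (v + j * c) mod m" using s0 by linarith
  moreover have "j < 2 * l - 1" using q by (auto simp: j_def)
  ultimately show ?thesis unfolding y_def by blast
qed

section \<open>Digit classes contain no progressions\<close>

definition digit_count :: "nat \<Rightarrow> (nat \<Rightarrow> nat) \<Rightarrow> nat \<Rightarrow> nat" where
  "digit_count n x a = card {i. i < n \<and> x i = a}"

text \<open>Since \<open>w 0 = 0\<close>, digit 0 drops out, so a class only has to prescribe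
  \<open>d - 1\<close> counts. This number becomes the exponent of \<open>sqrt n\<close> in the
  final bound.\<close>

lemma sum_weight_eq_digit_count:
  fixes w :: "nat \<Rightarrow> nat"
  assumes "\<And>i. i < n \<Longrightarrow> x i < d" "w 0 = 0"
  shows "(\<Sum>i<n. w (x i)) = (\<Sum>a\<in>{1..<d}. w a * digit_count n x a)"
proof -
  have "(\<Sum>i<n. w (x i)) = (\<Sum>i<n. \<Sum>a<d. if x i = a then w a else 0)"
    using assms by (intro sum.cong) (auto simp: sum.delta)
  also have "\<dots> = (\<Sum>a<d. \<Sum>i<n. if x i = a then w a else 0)" by (rule sum.swap)
  also have "\<dots> = (\<Sum>a<d. w a * digit_count n x a)"
    by (intro sum.cong) (auto simp: digit_count_def sum.If_cases Int_def mult.commute)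
  also have "\<dots> = (\<Sum>a\<in>{1..<d}. w a * digit_count n x a)"
    using assms(2) by (intro sum.mono_neutral_right) (auto simp: not_le)
  finally show ?thesis .
qed

text \<open>All \<open>k\<close> terms have the same total weight, so together they weigh
  \<open>k\<close> times the middle term. Coordinatewise they weigh at least that much, and strictly
  more wherever \<open>c i \<noteq> 0\<close>.\<close>

lemma digit_class_AP_free:
  fixes m l n d :: nat and t :: "nat \<Rightarrow> nat"
  assumes m: "m \<ge> 2" and l: "l \<ge> 2"
    and cop: "\<And>q. 1 \<le> q \<Longrightarrow> q \<le> l \<Longrightarrow> coprime q m"
    and d: "d = ((l - 1) * m) div l + 1"
  shows "\<not> contains_AP (2 * l - 1) m n
    {x \<in> {..<n} \<rightarrow>\<^sub>E {..<d}. \<forall>a\<in>{1..<d}. digit_count n x a = t a}"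
proof
  define k where "k = 2 * l - 1"
  define A where "A = {x \<in> {..<n} \<rightarrow>\<^sub>E {..<d}. \<forall>a\<in>{1..<d}. digit_count n x a = t a}"
  assume "contains_AP (2 * l - 1) m n
    {x \<in> {..<n} \<rightarrow>\<^sub>E {..<d}. \<forall>a\<in>{1..<d}. digit_count n x a = t a}"
  then obtain v c where vc: "v \<in> zmod_vecs m n" "c \<in> zmod_vecs m n" "c \<noteq> zmod_zero n"
    and inA: "\<And>j. j < k \<Longrightarrow> zmod_add m n v (zmod_mult m n j c) \<in> A"
    unfolding contains_AP_def A_def k_def by blast
  define x where "x j = zmod_add m n v (zmod_mult m n j c)" for j
  have x: "x j i = (v i + j * c i) mod m" if "i < n" for i j
    using that by (simp add: x_def zmod_add_def zmod_mult_def mod_add_right_eq)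
  have xd: "x j i < d" if "i < n" "j < k" for i j
    using inA[OF that(2)] that(1) by (auto simp: A_def x_def[symmetric])
  \<comment> \<open>Base \<open>k\<close> makes a single larger digit outweigh \<open>k\<close>
    copies of the middle one, whatever the remaining terms are; subtracting 1 gives
    \<open>w 0 = 0\<close>.\<close>
  define w where "w a = k ^ a - 1" for a :: nat
  have k3: "k \<ge> 3" using l by (simp add: k_def)
  have w_jump: "k * w a < w b" if "a < b" for a b
  proof -
    have "k ^ Suc a \<le> k ^ b" using that k3 by (intro power_increasing) auto
    moreover have "k ^ Suc a \<ge> k" using k3 by simp
    ultimately have "k * k ^ a - k < k ^ b - 1" using k3 unfolding power_Suc by linarith
    then show ?thesis by (simp add: w_def diff_mult_distrib2)
  qed
  have weight: "(\<Sum>i<n. w (x j i)) = (\<Sum>a\<in>{1..<d}. w a * t a)" if "j < k" for j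
  proof -
    have "(\<Sum>i<n. w (x j i)) = (\<Sum>a\<in>{1..<d}. w a * digit_count n (x j) a)"
      by (rule sum_weight_eq_digit_count) (use xd that in \<open>auto simp: w_def\<close>)
    also have "\<dots> = (\<Sum>a\<in>{1..<d}. w a * t a)"
      using inA[OF that] by (intro sum.cong) (auto simp: A_def x_def)
    finally show ?thesis .
  qed
  have lk: "l - 1 < k" using l by (simp add: k_def)
  have strict: "k * w (x (l - 1) i) < (\<Sum>j<k. w (x j i))" if i: "i < n" "c i \<noteq> 0" for i
  proof -
    have "c i < m" using vc(2) i by (auto simp: zmod_vecs_def)
    moreover have "(v i + (l - 1) * c i) mod m \<le> ((l - 1) * m) div l"
      using xd[OF i(1) lk] i by (simp add: x d)
    ultimately obtain j where j: "j < k" "x (l - 1) i < x j i"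
      using exists_larger_term[of m l "c i" "v i"] m l cop i by (auto simp: x k_def)
    have "k * w (x (l - 1) i) < w (x j i)" using j by (intro w_jump)
    also have "\<dots> \<le> (\<Sum>j<k. w (x j i))" using j by (intro member_le_sum) auto
    finally show ?thesis .
  qed
  have weak: "k * w (x (l - 1) i) \<le> (\<Sum>j<k. w (x j i))" if "i < n" for i
    using strict[OF that] that by (cases "c i = 0") (auto simp: x)
  obtain i where "i < n" "c i \<noteq> 0"
  proof (rule ccontr)
    assume "\<not> thesis"
    then have "\<And>i. i < n \<Longrightarrow> c i = 0" using that by blast
    then have "c = zmod_zero n"
      using vc(2) by (auto simp: zmod_vecs_def zmod_zero_def PiE_def extensional_def)
    with vc(3) show False by simp
  qed
  then have "(\<Sum>i<n. k * w (x (l - 1) i)) < (\<Sum>i<n. \<Sum>j<k. w (x j i))"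
    using strict weak by (intro sum_strict_mono_ex1) auto
  also have "\<dots> = (\<Sum>j<k. \<Sum>i<n. w (x j i))" by (rule sum.swap)
  also have "\<dots> = k * (\<Sum>a\<in>{1..<d}. w a * t a)" by (simp add: weight)
  also have "\<dots> = (\<Sum>i<n. k * w (x (l - 1) i))"
    using weight[OF lk] by (simp add: sum_distrib_left[symmetric])
  finally show False by simp
qed

section \<open>Second moment of the digit counts\<close>

text \<open>Additivity of variance for \<open>n\<close> independent uniform choices from
  \<open>D\<close>, in counting form; the factor \<open>card D\<close> on the left avoids the
  exponent \<open>n - 1\<close>. In the induction the cross term vanishes because \<open>g\<close>
  has sum 0.\<close>

lemma sum_PiE_square_centered:
  fixes g :: "'a \<Rightarrow> real"
  assumes "finite D" "sum g D = 0"
  shows "(\<Sum>x\<in>{..<n} \<rightarrow>\<^sub>E D. (\<Sum>i<n. g (x i))\<^sup>2) * card D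
    = real n * real (card D) ^ n * (\<Sum>a\<in>D. (g a)\<^sup>2)"
proof (induction n)
  case 0
  then show ?case by simp
next
  case (Suc n)
  let ?P = "{..<n} \<rightarrow>\<^sub>E D"
  let ?G = "\<lambda>x. \<Sum>i<n. g (x i)"
  have fin: "finite ?P" using assms by (intro finite_PiE) auto
  have inj: "inj_on (\<lambda>(y, x). x(n := y)) (D \<times> ?P)"
    by (rule inj_combinator) simp
  have "(\<Sum>x\<in>{..<Suc n} \<rightarrow>\<^sub>E D. (\<Sum>i<Suc n. g (x i))\<^sup>2)
      = (\<Sum>(y, x)\<in>D \<times> ?P. (?G x + g y)\<^sup>2)"
    unfolding lessThan_Suc PiE_insert_eq sum.reindex[OF inj]
    by (auto simp: case_prod_unfold add.commute intro!: sum.cong)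
  also have "\<dots> = (\<Sum>y\<in>D. \<Sum>x\<in>?P. (?G x)\<^sup>2 + (2 * ?G x) * g y + (g y)\<^sup>2)"
    by (simp add: sum.cartesian_product[symmetric] power2_sum algebra_simps)
  also have "\<dots> = (\<Sum>x\<in>?P. (?G x)\<^sup>2) * card D + (\<Sum>y\<in>D. \<Sum>x\<in>?P. (2 * ?G x) * g y)
      + card ?P * (\<Sum>y\<in>D. (g y)\<^sup>2)"
    by (simp add: sum.distrib sum_distrib_left mult.commute)
  also have "(\<Sum>y\<in>D. \<Sum>x\<in>?P. (2 * ?G x) * g y) = (\<Sum>x\<in>?P. 2 * ?G x) * sum g D"
    by (simp only: sum_product sum.swap[of _ D])
  also have "real (card ?P) = real (card D) ^ n" by (simp add: card_PiE)
  finally show ?case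
    using Suc.IH assms(2) by (simp add: algebra_simps)
qed

text \<open>Each count has variance \<open>n * (1 / d) * (1 - 1 / d)\<close>, at most
  \<open>n / d\<close>, and there are \<open>d\<close> digits. Here \<open>g a\<close> is the
  centred indicator of the digit \<open>a\<close>.\<close>

lemma sum_PiE_digit_count_variance:
  assumes "d > 0"
  shows "(\<Sum>x\<in>{..<n} \<rightarrow>\<^sub>E {..<d}. \<Sum>a<d. (real (digit_count n x a) - real n / real d)\<^sup>2)
    \<le> real n * real d ^ n"
proof -
  define g where "g a b = (if b = a then 1 else 0) - 1 / real d" for a b :: nat
  have G: "(\<Sum>i<n. g a (x i)) = real (digit_count n x a) - real n / real d" for x a
    by (simp add: g_def sum_subtractf digit_count_def sum.If_cases Int_def)
  have var: "(\<Sum>x\<in>{..<n} \<rightarrow>\<^sub>E {..<d}. (\<Sum>i<n. g a (x i))\<^sup>2) * real d \<le> real n * real d ^ n"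
    if a: "a < d" for a
  proof -
    have g0: "(\<Sum>b<d. g a b) = 0"
      using a by (simp add: g_def sum_subtractf)
    have "(\<Sum>b<d. (g a b)\<^sup>2)
        = (\<Sum>b<d. (if b = a then 1 else 0) * (1 - 2 / real d) + 1 / (real d)\<^sup>2)"
      by (intro sum.cong) (auto simp: g_def power2_eq_square algebra_simps)
    also have "\<dots> = (1 - 2 / real d) + real d * (1 / (real d)\<^sup>2)"
      unfolding sum.distrib sum_distrib_right[symmetric] using a by simp
    also have "\<dots> = 1 - 1 / real d"
      using a by (simp add: power2_eq_square field_simps)
    also have "\<dots> \<le> 1" by simp
    finally have "real n * real d ^ n * (\<Sum>b<d. (g a b)\<^sup>2) \<le> real n * real d ^ n * 1"
      by (intro mult_left_mono) auto
    then show ?thesis using sum_PiE_square_centered[of "{..<d}" "g a" n] g0 by simp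
  qed
  have "(\<Sum>x\<in>{..<n} \<rightarrow>\<^sub>E {..<d}. \<Sum>a<d. (\<Sum>i<n. g a (x i))\<^sup>2) * real d
      = (\<Sum>a<d. (\<Sum>x\<in>{..<n} \<rightarrow>\<^sub>E {..<d}. (\<Sum>i<n. g a (x i))\<^sup>2) * real d)"
    by (subst sum.swap) (simp add: sum_distrib_right)
  also have "\<dots> \<le> (\<Sum>a<d. real n * real d ^ n)" using var by (intro sum_mono) auto
  also have "\<dots> = real n * real d ^ n * real d" by simp
  finally show ?thesis using assms by (simp add: G)
qed

section \<open>Typical vectors and a popular digit class\<close>

lemma finite_nat_near: "finite {a::nat. \<bar>real a - c\<bar> \<le> r}"
  by (rule finite_subset[of _ "{..nat \<lfloor>c + r\<rfloor>}"]) (auto simp: le_nat_floor)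

lemma card_nat_near:
  assumes "r \<ge> 0"
  shows "real (card {a::nat. \<bar>real a - c\<bar> \<le> r}) \<le> 2 * r + 1"
proof (cases "{a::nat. \<bar>real a - c\<bar> \<le> r} = {}")
  case True
  then show ?thesis using assms by simp
next
  case False
  let ?S = "{a::nat. \<bar>real a - c\<bar> \<le> r}"
  have "?S \<subseteq> {Min ?S..Max ?S}" using finite_nat_near by auto
  then have "card ?S \<le> card {Min ?S..Max ?S}" by (intro card_mono) auto
  moreover have "Min ?S \<in> ?S" "Max ?S \<in> ?S" using False finite_nat_near by (intro Min_in Max_in; blast)+
  ultimately show ?thesis by (auto simp: abs_le_iff)
qed

text \<open>The total squared deviation \<open>V\<close> has mean at most \<open>n\<close> and is at
  least \<open>2 * n\<close> on atypical vectors, which are thus at most half of all. Summing over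
  the digits first keeps the radius independent of \<open>d\<close>.\<close>

lemma card_typical_digit_counts:
  assumes "d > 0"
  shows "real d ^ n \<le> 2 * real (card {x \<in> {..<n} \<rightarrow>\<^sub>E {..<d}.
    \<forall>a<d. \<bar>real (digit_count n x a) - real n / real d\<bar> \<le> sqrt (2 * real n)})"
proof (cases "n = 0")
  case True
  then show ?thesis by (simp add: digit_count_def)
next
  case False
  let ?P = "{..<n} \<rightarrow>\<^sub>E {..<d}"
  define V where "V x = (\<Sum>a<d. (real (digit_count n x a) - real n / real d)\<^sup>2)" for x
  define T where "T = {x \<in> ?P.
    \<forall>a<d. \<bar>real (digit_count n x a) - real n / real d\<bar> \<le> sqrt (2 * real n)}"
  have fin: "finite ?P" by (intro finite_PiE) auto
  have big: "2 * real n \<le> V x" if x: "x \<in> ?P - T" for x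
  proof -
    obtain a where a: "a < d" "sqrt (2 * real n) < \<bar>real (digit_count n x a) - real n / real d\<bar>"
      using x by (auto simp: T_def not_le)
    have "2 * real n = (sqrt (2 * real n))\<^sup>2" by simp
    also have "\<dots> \<le> \<bar>real (digit_count n x a) - real n / real d\<bar>\<^sup>2"
      using a by (intro power_mono) auto
    also have "\<dots> = (real (digit_count n x a) - real n / real d)\<^sup>2" by simp
    also have "\<dots> \<le> V x" unfolding V_def using a by (intro member_le_sum) auto
    finally show ?thesis .
  qed
  have "real (card (?P - T)) * (2 * real n) \<le> (\<Sum>x\<in>?P - T. V x)"
    by (rule sum_bounded_below) (rule big)
  also have "\<dots> \<le> (\<Sum>x\<in>?P. V x)"
    by (rule sum_mono2[OF fin]) (simp_all add: V_def sum_nonneg)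
  also have "\<dots> \<le> real n * real d ^ n"
    unfolding V_def by (rule sum_PiE_digit_count_variance[OF assms])
  finally have "real n * (2 * real (card (?P - T))) \<le> real n * real d ^ n" by (simp add: algebra_simps)
  then have "2 * real (card (?P - T)) \<le> real d ^ n" using False by simp
  moreover have "T \<subseteq> ?P" by (auto simp: T_def)
  then have "card (?P - T) + card T = d ^ n"
    using fin card_Diff_subset[of T ?P] card_mono[of ?P T] finite_subset[of T ?P]
    by (simp add: card_PiE)
  then have "real (card (?P - T)) + real (card T) = real d ^ n" by (metis of_nat_add of_nat_power)
  ultimately show ?thesis by (simp add: T_def)
qed

text \<open>Pigeonhole: the classes indexed by \<open>Q\<close> cover the typical vectors, and
  \<open>Q\<close> has at most \<open>(4 * sqrt n) ^ (d - 1)\<close> elements.\<close>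

lemma large_digit_class:
  assumes "d > 0" "n \<ge> 1"
  shows "\<exists>t. real d ^ n \<le> 2 * (4 * sqrt (real n)) ^ (d - 1) *
    real (card {x \<in> {..<n} \<rightarrow>\<^sub>E {..<d}. \<forall>a\<in>{1..<d}. digit_count n x a = t a})"
proof -
  let ?P = "{..<n} \<rightarrow>\<^sub>E {..<d}"
  define N where "N = {a::nat. \<bar>real a - real n / real d\<bar> \<le> sqrt (2 * real n)}"
  define T where "T = {x \<in> ?P.
    \<forall>a<d. \<bar>real (digit_count n x a) - real n / real d\<bar> \<le> sqrt (2 * real n)}"
  define Q where "Q = {1..<d} \<rightarrow>\<^sub>E N"
  define cl where "cl t = {x \<in> ?P. \<forall>a\<in>{1..<d}. digit_count n x a = t a}" for t
  define M where "M = Max ((\<lambda>t. card (cl t)) ` Q)"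
  have finP: "finite ?P" by (intro finite_PiE) auto
  have finQ: "finite Q" unfolding Q_def N_def by (intro finite_PiE finite_nat_near) auto
  have cover: "T \<subseteq> (\<Union>t\<in>Q. cl t)"
  proof
    fix x assume x: "x \<in> T"
    have "restrict (digit_count n x) {1..<d} \<in> Q" using x by (auto simp: Q_def N_def T_def)
    moreover have "x \<in> cl (restrict (digit_count n x) {1..<d})" using x by (auto simp: cl_def T_def)
    ultimately show "x \<in> (\<Union>t\<in>Q. cl t)" by blast
  qed
  have typical: "real d ^ n \<le> 2 * real (card T)"
    unfolding T_def by (rule card_typical_digit_counts[OF assms(1)])
  \<comment> \<open>Positivity makes \<open>T\<close>, hence \<open>Q\<close>, nonempty, so that the
    maximum \<open>M\<close> is attained by some class.\<close>
  have "real d ^ n > 0" using assms by simp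
  with typical have "T \<noteq> {}" by (metis card.empty mult_zero_right not_le of_nat_0)
  with cover have "Q \<noteq> {}" by auto
  then have "M \<in> (\<lambda>t. card (cl t)) ` Q" unfolding M_def using finQ by (intro Max_in) auto
  then obtain t where t: "M = card (cl t)" by auto
  have "card T \<le> card (\<Union>t\<in>Q. cl t)"
    using cover finQ finP by (intro card_mono) (auto simp: cl_def)
  also have "\<dots> \<le> (\<Sum>t\<in>Q. card (cl t))" using finQ by (rule card_UN_le)
  also have "\<dots> \<le> (\<Sum>t\<in>Q. M)" unfolding M_def using finQ by (intro sum_mono Max_ge) auto
  finally have "real (card T) \<le> real (card Q * M)" by (simp only: of_nat_le_iff sum_constant of_nat_id)
  then have 1: "real (card T) \<le> real (card Q) * real M" by simp
  have "real (card N) \<le> 2 * sqrt (2 * real n) + 1"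
    unfolding N_def by (rule card_nat_near) simp
  \<comment> \<open>Splits as \<open>3 * sqrt n + sqrt n\<close>, the last summand absorbing the 1
    because \<open>n \<ge> 1\<close>.\<close>
  also have "\<dots> \<le> 4 * sqrt (real n)"
  proof -
    have "sqrt 2 \<le> 3 / 2" by (rule real_le_lsqrt) (auto simp: power2_eq_square)
    then have "sqrt 2 * sqrt (real n) \<le> 3 / 2 * sqrt (real n)" by (intro mult_right_mono) auto
    moreover have "1 \<le> sqrt (real n)" using assms by simp
    ultimately show ?thesis unfolding real_sqrt_mult by linarith
  qed
  finally have "real (card N) ^ (d - 1) \<le> (4 * sqrt (real n)) ^ (d - 1)" by (intro power_mono) auto
  then have "real (card Q) \<le> (4 * sqrt (real n)) ^ (d - 1)" by (simp add: Q_def card_PiE)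
  then have "real (card Q) * real M \<le> (4 * sqrt (real n)) ^ (d - 1) * real M"
    by (intro mult_right_mono) auto
  with typical 1 have "real d ^ n \<le> 2 * (4 * sqrt (real n)) ^ (d - 1) * real (card (cl t))"
    by (simp add: t)
  then show ?thesis unfolding cl_def by blast
qed

section \<open>From digit classes to the bound on \<open>r_AP\<close>\<close>

lemma card_le_r_AP:
  assumes "A \<subseteq> zmod_vecs m n" "\<not> contains_AP k m n A"
  shows "card A \<le> r_AP k m n"
proof -
  have fin: "finite (zmod_vecs m n)" unfolding zmod_vecs_def by (intro finite_PiE) auto
  have "{card A | A. A \<subseteq> zmod_vecs m n \<and> \<not> contains_AP k m n A} \<subseteq> card ` Pow (zmod_vecs m n)"
    by auto
  then have "finite {card A | A. A \<subseteq> zmod_vecs m n \<and> \<not> contains_AP k m n A}"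
    using fin by (meson finite_Pow_iff finite_imageI finite_subset)
  then show ?thesis unfolding r_AP_def using assms by (intro Max_ge) auto
qed

lemma coprime_below_least_prime_factor:
  assumes "m > 0" "1 \<le> q" "q < least_prime_factor m"
  shows "coprime q m"
proof (rule ccontr)
  assume "\<not> coprime q m"
  then obtain p where p: "prime p" "p dvd q" "p dvd m"
    using assms by (metis coprime_iff_gcd_eq_1 gcd_dvd1 gcd_dvd2 prime_factor_nat dvd_trans)
  then have "p \<in> prime_factors m" using assms by (simp add: in_prime_factors_iff)
  then have "least_prime_factor m \<le> p" unfolding least_prime_factor_def by (intro Min_le) auto
  moreover have "p \<le> q" using p assms by (intro dvd_imp_le) auto
  ultimately show False using assms by simp
qed

theorem theorem1p1:
  fixes m k :: nat
  assumes "m \<ge> 2" and "k \<ge> 5" and "odd k"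
    and "real (least_prime_factor m) \<ge> (real k + 2) / 2"
  shows "\<exists>C::real. C > 0 \<and>
    (\<forall>n::nat. n \<ge> 1 \<longrightarrow>
      real (r_AP k m n) \<ge>
        C * (real_of_int \<lfloor>(real k - 1) / (real k + 1) * real m + 1\<rfloor> ^ n
             / real n powr (real_of_int \<lfloor>(real k - 1) / (real k + 1) * real m\<rfloor> / 2)))"
proof -
  define l where "l = (k + 1) div 2"
  have k: "k = 2 * l - 1" "l \<ge> 3" using assms(2,3) by (auto simp: l_def elim!: oddE)
  then have rk: "real k = 2 * real l - 1" by (simp add: of_nat_diff)
  define e where "e = ((l - 1) * m) div l"
  define d where "d = e + 1"
  \<comment> \<open>The hypothesis on the least prime factor reads \<open>l + 1 / 2\<close>, so
    every positive integer up to \<open>l\<close> lies below it.\<close>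
  have cop: "coprime q m" if "1 \<le> q" "q \<le> l" for q
    using assms(1,4) that by (intro coprime_below_least_prime_factor) (auto simp: rk)
  \<comment> \<open>With \<open>k = 2 * l - 1\<close> the ratio is \<open>(l - 1) / l\<close>, so
    the two floors in the claim are \<open>e\<close> and \<open>d\<close>.\<close>
  have "(real k - 1) / (real k + 1) * real m = real ((l - 1) * m) / real l"
    using k by (simp add: rk of_nat_diff field_simps)
  then have fl: "\<lfloor>(real k - 1) / (real k + 1) * real m\<rfloor> = int e"
    by (simp only: e_def floor_divide_of_nat_eq)
  then have fl': "\<lfloor>(real k - 1) / (real k + 1) * real m + 1\<rfloor> = int d"
    by (simp add: d_def)
  have "e < m"
  proof -
    have "(l - 1) * m < m * l" using k assms(1) by (simp add: mult.commute)
    then show ?thesis using k by (simp add: e_def div_less_iff_less_mult)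
  qed
  \<comment> \<open>The reciprocal of the constant factor in the pigeonhole bound, with
    \<open>e = d - 1\<close>.\<close>
  define C where "C = 1 / (2 * 4 ^ e :: real)"
  have "C * (real d ^ n / real n powr (real e / 2)) \<le> real (r_AP k m n)" if n: "n \<ge> 1" for n
  proof -
    obtain t where t: "real d ^ n \<le> 2 * (4 * sqrt (real n)) ^ (d - 1) *
        real (card {x \<in> {..<n} \<rightarrow>\<^sub>E {..<d}. \<forall>a\<in>{1..<d}. digit_count n x a = t a})"
      using large_digit_class[of d n] n by (auto simp: d_def)
    define A where "A = {x \<in> {..<n} \<rightarrow>\<^sub>E {..<d}. \<forall>a\<in>{1..<d}. digit_count n x a = t a}"
    have "\<not> contains_AP k m n A"
      unfolding A_def k(1) using assms(1) k(2) cop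
      by (intro digit_class_AP_free) (auto simp: d_def e_def)
    moreover have "A \<subseteq> zmod_vecs m n"
    proof -
      have "{..<n} \<rightarrow>\<^sub>E {..<d} \<subseteq> {..<n} \<rightarrow>\<^sub>E {..<m}"
        using \<open>e < m\<close> by (intro PiE_mono) (auto simp: d_def)
      then show ?thesis by (auto simp: A_def zmod_vecs_def)
    qed
    ultimately have r: "real (card A) \<le> real (r_AP k m n)" by (simp add: card_le_r_AP)
    have "real n powr (real e / 2) = sqrt (real n) ^ e"
      using n by (simp add: powr_half_sqrt[symmetric] powr_realpow[symmetric] powr_powr)
    then have "C * (real d ^ n / real n powr (real e / 2))
        = real d ^ n / (2 * (4 * sqrt (real n)) ^ e)"
      by (simp add: C_def power_mult_distrib)
    also have "\<dots> \<le> real (card A)"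
      using t[folded A_def] n by (simp add: d_def divide_le_eq mult.commute)
    finally show ?thesis using r by linarith
  qed
  moreover have "C > 0" by (simp add: C_def)
  ultimately show ?thesis unfolding fl fl' by (intro exI[of _ C]) auto
qed

end
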